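(* Let $C, D \subset \mathbb{R}^2$ be convex bodies. Then there exists a constant $\rho(C,D)>0$, depending only on $C$ and $D$, such that for every $n\ge 1$ and every packing $S$ of $n$ positive homothets of $C$ in $D$, $$\mathrm{per}(S) \le \rho(C,D)\,\sqrt{n}.$$ Apart from the multiplicative constant this bound is the best possible: there exists a constant $\sigma(C,D)>0$, depending only on $C$ and $D$, such that for every $n\ge 1$ there is a packing $S$ of $n$ positive homothets of $C$ in $D$ with $\mathrm{per}(S)\ge \sigma(C,D)\sqrt{n}$.
   Context: A convex body is a compact convex subset of $\mathbb{R}^2$ with nonempty interior. A positive homothet of $C$ is a set of the form $\mu C + v$ with $\mu>0$ and $v\in\mathbb{R}^2$. A finite set $S=\{C_1,\dots,C_n\}$ of convex bodies is a packing in a convex body $D$ if all $C_i$ are contained in $D$ and the $C_i$ have pairwise disjoint interiors. $\mathrm{per}(C)$ denotes the perimeter of a convex body $C$, and $\mathrm{per}(S)=\sum_{i=1}^n \mathrm{per}(C_i)$. *)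

theory Defs
  imports "HOL-Analysis.Analysis"
begin

definition convex_body :: "(real^2) set \<Rightarrow> bool" where
  "convex_body K \<longleftrightarrow> compact K \<and> convex K \<and> interior K \<noteq> {}"

definition positive_homothet :: "(real^2) set \<Rightarrow> (real^2) set \<Rightarrow> bool" where
  "positive_homothet C K \<longleftrightarrow> (\<exists>\<mu> v. \<mu> > 0 \<and> K = (\<lambda>x. \<mu> *\<^sub>R x + v) ` C)"

definition packing :: "(real^2) set set \<Rightarrow> (real^2) set \<Rightarrow> bool" where
  "packing S D \<longleftrightarrow> finite S \<and> (\<forall>K\<in>S. convex_body K \<and> K \<subseteq> D) \<and>
     pairwise (\<lambda>K L. interior K \<inter> interior L = {}) S"

(* The length of a boundary is its one-dimensional Hausdorff measure, normalised so that a segment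
   has its usual length; for the boundary curve of a planar convex body this is its arc length.
   Covers are countable and may contain empty sets. The boundedness condition is needed because
   "diameter" is unspecified on unbounded sets. *)
definition length_measure_delta :: "real \<Rightarrow> 'a::metric_space set \<Rightarrow> ennreal" where
  "length_measure_delta \<delta> A =
     (INF U \<in> {U :: nat \<Rightarrow> 'a set. A \<subseteq> (\<Union>i. U i) \<and> (\<forall>i. bounded (U i) \<and> diameter (U i) \<le> \<delta>)}.
        \<Sum>i. ennreal (diameter (U i)))"

definition length_measure :: "'a::metric_space set \<Rightarrow> ennreal" where
  "length_measure A = (SUP \<delta>\<in>{0<..}. length_measure_delta \<delta> A)"

(* Values are in ennreal, so an upper bound by a finite number also asserts finiteness. *)
definition perimeter :: "(real^2) set \<Rightarrow> ennreal" where
  "perimeter K = length_measure (frontier K)"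

definition total_perimeter :: "(real^2) set set \<Rightarrow> ennreal" where
  "total_perimeter S = (\<Sum>K\<in>S. perimeter K)"

end

theory Submission
  imports Defs
begin

text \<open>Up to constants, perimeter measures linear size: a bounded set containing a disc of
  radius r has perimeter at least r (\<open>perimeter_ge_inradius\<close>), and a convex body inside
  a disc of radius R has perimeter at most 4 pi R (\<open>perimeter_le_circumradius\<close>).
  Neither constant is sharp, and neither has to be. Fix one disc inside \<open>C\<close> and one
  around it; then a homothet of ratio \<mu> has perimeter between two fixed multiples of \<mu>, and
  only sums of ratios have to be estimated.

  Upper bound: the homothets contain disjoint discs of area proportional to \<mu>^2, all inside
  \<open>D\<close>, so the sum of the \<mu>^2 is bounded in terms of \<open>C\<close> and
  \<open>D\<close>. By Cauchy-Schwarz the sum of n ratios is then at most a constant times sqrt n.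

  Lower bound: n translates of one small copy of \<open>C\<close>, with ratio of order 1 / sqrt n,
  are placed on a square grid inside a disc of \<open>D\<close>. Their perimeters add up to order n
  / sqrt n = sqrt n.\<close>

section \<open>Estimates for one-dimensional Hausdorff measure\<close>

text \<open>Cutting the parameter interval into N equal pieces covers the curve by N sets of
  diameter at most L / N. Their diameters add up to at most L however fine the cover has to
  be.\<close>

lemma length_measure_Lipschitz_image_le:
  fixes f :: "real \<Rightarrow> 'a::metric_space"
  assumes lip: "\<And>s t. dist (f s) (f t) \<le> L * \<bar>s - t\<bar>" and L: "L \<ge> 0"
    and sub: "A \<subseteq> f ` {0..1}"
  shows "length_measure A \<le> ennreal L"
  unfolding length_measure_def
proof (rule SUP_least)
  fix \<delta> :: real assume "\<delta> \<in> {0<..}"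
  then have \<delta>: "\<delta> > 0" by simp
  obtain N :: nat where N: "L / \<delta> < real N" using reals_Archimedean2 by blast
  have N0: "real N > 0" using N L \<delta> by (smt (verit) divide_nonneg_pos)
  \<comment> \<open>Covers are indexed by all natural numbers, so the N arcs are padded with empty
    sets, whose diameter is 0.\<close>
  define V where "V i = (if i < N then f ` {real i / N .. real (Suc i) / N} else {})" for i
  have dV: "dist x y \<le> L / N" if "x \<in> V i" "y \<in> V i" for x y i
  proof -
    have "i < N" using that(1) by (auto simp: V_def split: if_splits)
    then have "x \<in> f ` {real i / N .. real (Suc i) / N}" "y \<in> f ` {real i / N .. real (Suc i) / N}"
      using that by (simp_all only: V_def if_True)
    then obtain s t where st: "s \<in> {real i / N .. real (Suc i) / N}" "t \<in> {real i / N .. real (Suc i) / N}"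
      "x = f s" "y = f t"
      by (elim imageE)
    have "real (Suc i) / N - real i / N = 1 / N" by (simp add: diff_divide_distrib[symmetric])
    then have "\<bar>s - t\<bar> \<le> 1 / N" using st(1,2) unfolding atLeastAtMost_iff by linarith
    then have "L * \<bar>s - t\<bar> \<le> L * (1 / N)" using L by (rule mult_left_mono)
    then show ?thesis using lip[of s t] st by simp
  qed
  have LN: "0 \<le> L / N" using L by simp
  have bV: "bounded (V i)" for i
    unfolding bounded_two_points using dV by blast
  have diamV: "diameter (V i) \<le> L / N" for i
    using dV LN unfolding diameter_def by (auto intro!: cSUP_least)
  have cover: "A \<subseteq> (\<Union>i. V i)"
  proof
    fix x assume "x \<in> A"
    then obtain t where t: "t \<in> {0..1}" "x = f t" using sub by blast
    \<comment> \<open>At t = 1 the floor would give N, one past the last arc, so the endpoint is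
      assigned to arc N - 1.\<close>
    define i where "i = (if t = 1 then N - 1 else nat \<lfloor>t * N\<rfloor>)"
    have "i < N \<and> t \<in> {real i / N .. real (Suc i) / N}"
    proof (cases "t = 1")
      case True then show ?thesis using N0 by (simp add: i_def field_simps of_nat_diff)
    next
      case False
      then have "t < 1" "t \<ge> 0" using t by auto
      then have "t * N < N" "0 \<le> t * N" using N0 by auto
      moreover have "real i = of_int \<lfloor>t * N\<rfloor>" using False \<open>0 \<le> t * N\<close> by (simp add: i_def)
      ultimately have "real i \<le> t * N" "t * N < real i + 1" "real i < real N" by linarith+
      then show ?thesis using N0 by (simp add: field_simps)
    qed
    then show "x \<in> (\<Union>i. V i)" using t(2) unfolding V_def by auto
  qed
  have "L / N \<le> \<delta>" using N N0 \<delta> by (simp add: field_simps)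
  then have "length_measure_delta \<delta> A \<le> (\<Sum>i. ennreal (diameter (V i)))"
    unfolding length_measure_delta_def
    using cover bV diamV by (intro INF_lower) (auto intro: order_trans)
  also have "\<dots> = (\<Sum>i<N. ennreal (diameter (V i)))"
    by (rule suminf_finite) (auto simp: V_def)
  also have "\<dots> \<le> (\<Sum>i<N. ennreal (L / N))"
    by (intro sum_mono ennreal_leI diamV)
  also have "\<dots> = ennreal (real N * (L / N))"
    using LN by (simp add: ennreal_mult' ennreal_of_nat_eq_real_of_nat del: times_divide_eq_right)
  also have "\<dots> = ennreal L" using N0 by simp
  finally show "length_measure_delta \<delta> A \<le> ennreal L" .
qed

text \<open>A coordinate projection does not increase distances, so a cover of \<open>A\<close>
  projects to a cover of the interval, and countable subadditivity of Lebesgue measure bounds the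
  sum of diameters from below.\<close>

lemma length_measure_ge_projection:
  fixes A :: "(real^'n) set"
  assumes sub: "{a<..<b} \<subseteq> (\<lambda>x. x $ i) ` A" and "a \<le> b"
  shows "ennreal ((b - a) / 2) \<le> length_measure A"
proof -
  \<comment> \<open>The mesh 1 is arbitrary: the supremum over all meshes dominates each of its
    terms.\<close>
  have "ennreal ((b - a) / 2) \<le> length_measure_delta 1 A"
    unfolding length_measure_delta_def
  proof (rule INF_greatest)
    fix U :: "nat \<Rightarrow> (real^'n) set"
    assume "U \<in> {U. A \<subseteq> (\<Union>i. U i) \<and> (\<forall>i. bounded (U i) \<and> diameter (U i) \<le> 1)}"
    then have cov: "A \<subseteq> (\<Union>i. U i)" and bd: "\<And>j. bounded (U j)" by auto
    \<comment> \<open>The interval is centred at the projection of an arbitrary point of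
      \<open>U j\<close> and has the full diameter as radius; this is the source of the factor 1/2.
      For empty \<open>U j\<close> the centre is arbitrary, but the interval shrinks to a
      point.\<close>
    define c where "c j = (SOME x. x \<in> U j) $ i" for j
    define J where "J j = {c j - diameter (U j) .. c j + diameter (U j)}" for j
    have inJ: "x $ i \<in> J j" if "x \<in> U j" for x j
    proof -
      have "(SOME x. x \<in> U j) \<in> U j" using that by (rule someI)
      then have "dist x (SOME x. x \<in> U j) \<le> diameter (U j)"
        using diameter_bounded_bound[OF bd that] by blast
      moreover have "dist (x $ i) (c j) \<le> dist x (SOME x. x \<in> U j)"
        unfolding c_def by (rule dist_vec_nth_le)
      ultimately show ?thesis by (auto simp: J_def dist_real_def)
    qed
    have dge: "diameter (U j) \<ge> 0" for j using diameter_ge_0[OF bd] .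
    have "{a<..<b} \<subseteq> (\<Union>j. J j)"
    proof
      fix t assume "t \<in> {a<..<b}"
      then obtain x where "x \<in> A" "t = x $ i" using sub by (meson imageE subsetD)
      moreover from \<open>x \<in> A\<close> obtain j where "x \<in> U j" using cov by (meson UN_E subsetD)
      ultimately show "t \<in> (\<Union>j. J j)" using inJ by blast
    qed
    then have "emeasure lborel {a<..<b} \<le> emeasure lborel (\<Union>j. J j)"
      by (intro emeasure_mono) (auto simp: J_def)
    also have "\<dots> \<le> (\<Sum>j. emeasure lborel (J j))"
      by (intro emeasure_subadditive_countably) (auto simp: J_def)
    also have "\<dots> = (\<Sum>j. 2 * ennreal (diameter (U j)))"
      using dge by (simp add: J_def ennreal_mult'')
    also have "\<dots> = 2 * (\<Sum>j. ennreal (diameter (U j)))"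
      by simp
    finally have *: "ennreal (b - a) \<le> 2 * (\<Sum>j. ennreal (diameter (U j)))"
      using \<open>a \<le> b\<close> by simp
    have "ennreal (b - a) = 2 * ennreal ((b - a) / 2)"
      using \<open>a \<le> b\<close> by (simp add: numeral_mult_ennreal)
    with * show "ennreal ((b - a) / 2) \<le> (\<Sum>j. ennreal (diameter (U j)))"
      by (simp add: ennreal_mult_le_mult_iff)
  qed
  also have "\<dots> \<le> length_measure A"
    unfolding length_measure_def by (rule SUP_upper) simp
  finally show ?thesis .
qed

section \<open>Perimeter against inner and outer discs\<close>

text \<open>Every vertical line through the open disc meets \<open>K\<close> and also leaves it,
  hence crosses the frontier. So the frontier projects onto an interval of length 2r.\<close>

lemma perimeter_ge_inradius:
  assumes "bounded K" and ball: "ball p r \<subseteq> K" and "r \<ge> 0"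
  shows "ennreal r \<le> perimeter K"
proof -
  have "{p$1 - r <..< p$1 + r} \<subseteq> (\<lambda>x. x $ 1) ` frontier K"
  proof
    fix t assume t: "t \<in> {p$1 - r <..< p$1 + r}"
    define g :: "real \<Rightarrow> real^2" where "g s = (\<chi> i. if i = 1 then t else p$2 + s)" for s
    have "continuous_on UNIV (\<lambda>s. if i = 1 then t else p$2 + s)" for i :: 2
      by (cases "i = 1") (auto intro: continuous_intros)
    then have gc: "continuous_on UNIV g" unfolding g_def by (intro continuous_on_vec_lambda)
    obtain B where B: "\<And>x. x \<in> K \<Longrightarrow> norm x \<le> B" using \<open>bounded K\<close> bounded_iff by blast
    have "g 0 - p = (t - p$1) *\<^sub>R axis 1 1"
      by (simp add: vec_eq_iff g_def axis_def forall_2)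
    then have "norm (g 0 - p) = \<bar>t - p$1\<bar>" by simp
    then have "g 0 \<in> ball p r" using t by (auto simp: dist_norm norm_minus_commute)
    then have "range g \<inter> K \<noteq> {}" using ball by blast
    \<comment> \<open>At this parameter the second coordinate is B + 1, above the norm bound B on
      \<open>K\<close>.\<close>
    moreover have "g (B + 1 - p$2) \<notin> K"
    proof
      assume "g (B + 1 - p$2) \<in> K"
      then have "norm (g (B + 1 - p$2)) \<le> B" by (rule B)
      moreover have "\<bar>g (B + 1 - p$2) $ 2\<bar> \<le> norm (g (B + 1 - p$2))" by (rule component_le_norm_cart)
      ultimately show False by (simp add: g_def)
    qed
    then have "range g - K \<noteq> {}" by blast
    moreover have "connected (range g)" using connected_continuous_image[OF gc] by simp
    ultimately have "range g \<inter> frontier K \<noteq> {}" by (intro connected_Int_frontier)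
    then obtain s where "g s \<in> frontier K" by blast
    moreover have "g s $ 1 = t" by (simp add: g_def)
    ultimately show "t \<in> (\<lambda>x. x $ 1) ` frontier K" by force
  qed
  from length_measure_ge_projection[OF this] \<open>r \<ge> 0\<close>
  show ?thesis by (simp add: perimeter_def)
qed

text \<open>The nearest-point map onto a closed convex set is 1-Lipschitz and maps an enclosing circle
  onto the frontier, which bounds the perimeter by the length of the circle.\<close>

lemma perimeter_le_circumradius:
  assumes K: "closed K" "convex K" "interior K \<noteq> {}" and sub: "K \<subseteq> ball p R"
  shows "perimeter K \<le> ennreal (4 * pi * R)"
proof -
  have K_ne: "K \<noteq> {}" using K(3) interior_subset by blast
  then have R: "R > 0" using sub by (cases "R \<le> 0") (auto simp: ball_empty)
  define e :: "real \<Rightarrow> real^2" where "e t = p + R *\<^sub>R (\<chi> i. if i = 1 then cos (2 * pi * t) else sin (2 * pi * t))" for t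
  have lip_sin: "\<bar>sin x - sin y\<bar> \<le> \<bar>x - y\<bar>" for x y :: real
  proof -
    have "\<bar>sin x - sin y\<bar> = 2 * \<bar>sin ((x - y)/2)\<bar> * \<bar>cos ((x+y)/2)\<bar>"
      by (simp add: sin_diff_sin abs_mult)
    also have "\<dots> \<le> 2 * \<bar>(x - y)/2\<bar> * 1"
      by (intro mult_mono abs_sin_x_le_abs_x) (auto simp: abs_sin_x_le_abs_x)
    finally show ?thesis by simp
  qed
  have lip_cos: "\<bar>cos x - cos y\<bar> \<le> \<bar>x - y\<bar>" for x y :: real
    using lip_sin[of "x + pi/2" "y + pi/2"] by (simp add: sin_add)
  have lip_e: "dist (e s) (e t) \<le> (4*pi*R) * \<bar>s - t\<bar>" for s t
  proof -
    \<comment> \<open>Adding the bounds of the two coordinates gives the constant 4 pi R, twice the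
      length of the circle.\<close>
    have "norm (e s - e t) \<le> (\<Sum>i\<in>UNIV. \<bar>(e s - e t) $ i\<bar>)" by (rule norm_le_l1_cart)
    also have "\<dots> = R * \<bar>cos (2 * pi * s) - cos (2 * pi * t)\<bar> +
        R * \<bar>sin (2 * pi * s) - sin (2 * pi * t)\<bar>"
      using R by (simp add: sum_2 e_def abs_mult right_diff_distrib[symmetric])
    also have "\<dots> \<le> R * \<bar>2 * pi * s - 2 * pi * t\<bar> + R * \<bar>2 * pi * s - 2 * pi * t\<bar>"
      using R by (intro add_mono mult_left_mono lip_sin lip_cos) auto
    also have "\<dots> = (4*pi*R) * \<bar>s - t\<bar>"
      by (simp add: right_diff_distrib[symmetric] abs_mult)
    finally show ?thesis by (simp add: dist_norm)
  qed
  define f where "f t = closest_point K (e t)" for t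
  have lip_f: "dist (f s) (f t) \<le> (4*pi*R) * \<bar>s - t\<bar>" for s t
    unfolding f_def by (rule order_trans[OF closest_point_lipschitz[OF K(2,1) K_ne] lip_e])
  have "frontier K \<subseteq> f ` {0..1}"
  proof
    fix x assume x: "x \<in> frontier K"
    then have xK: "x \<in> K" using K(1) frontier_subset_closed by blast
    have "x \<notin> rel_interior K"
      using x rel_interior_nonempty_interior[OF K(3)] by (simp add: frontier_def)
    then obtain a where a: "a \<noteq> 0" "\<forall>y\<in>K. a \<bullet> x \<le> a \<bullet> y"
      using supporting_hyperplane_rel_boundary[OF K(2) xK] by metis
    \<comment> \<open>The ray from x along the outer normal -a; all its points project back to
      x.\<close>
    define h where "h t = x - t *\<^sub>R a" for t
    have proj: "closest_point K (h t) = x" if "t \<ge> 0" for t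
    proof (rule closest_point_unique[OF K(2,1) xK, symmetric], intro ballI)
      fix z assume "z \<in> K"
      \<comment> \<open>The middle term is nonnegative by the choice of a, so no z in
        \<open>K\<close> is closer to \<open>h t\<close> than x is.\<close>
      have "(dist (h t) z)\<^sup>2 = (norm (x - z))\<^sup>2 + 2 * t * (a \<bullet> z - a \<bullet> x) + (norm (t *\<^sub>R a))\<^sup>2"
        unfolding h_def dist_norm power2_norm_eq_inner
        by (simp add: inner_diff_left inner_diff_right inner_commute algebra_simps)
      moreover have "0 \<le> 2 * t * (a \<bullet> z - a \<bullet> x)"
        using that a(2) \<open>z \<in> K\<close> by simp
      ultimately have "(norm (t *\<^sub>R a))\<^sup>2 \<le> (dist (h t) z)\<^sup>2"
        using zero_le_power2[of "norm (x - z)"] by linarith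
      moreover have "dist (h t) x = norm (t *\<^sub>R a)" by (simp add: h_def dist_norm)
      ultimately have "(dist (h t) x)\<^sup>2 \<le> (dist (h t) z)\<^sup>2" by (simp only:)
      then show "dist (h t) x \<le> dist (h t) z" by (rule power2_le_imp_le) simp
    qed
    \<comment> \<open>The ray starts inside the circle; at the upper limit it is 2R away from x,
      hence outside by the triangle inequality.\<close>
    have "\<exists>t\<ge>0. t \<le> 2 * R / norm a \<and> dist p (h t) = R"
    proof (rule IVT')
      have xR: "dist p x < R" using xK sub by auto
      then show "dist p (h 0) \<le> R" by (simp add: h_def)
      have "dist x (h (2 * R / norm a)) = 2 * R"
        using a(1) R by (simp add: h_def dist_norm)
      then show "R \<le> dist p (h (2 * R / norm a))"
        using xR dist_triangle[of x "h (2 * R / norm a)" p] by (simp add: dist_commute)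
      show "0 \<le> 2 * R / norm a" using R by simp
      show "continuous_on {0..2 * R / norm a} (\<lambda>t. dist p (h t))"
        unfolding h_def by (intro continuous_intros)
    qed
    then obtain t where t: "t \<ge> 0" "dist p (h t) = R" by blast
    define z where "z = (1/R) *\<^sub>R (h t - p)"
    have "norm z = 1" using t(2) R by (simp add: z_def dist_norm norm_minus_commute)
    then have "(z$1)\<^sup>2 + (z$2)\<^sup>2 = 1" by (simp add: norm_vec_def L2_set_def sum_2)
    then obtain \<theta> where \<theta>: "0 \<le> \<theta>" "\<theta> < 2*pi" "z$1 = cos \<theta>" "z$2 = sin \<theta>"
      by (rule sincos_total_2pi)
    have "e (\<theta> / (2*pi)) = p + R *\<^sub>R z"
      unfolding e_def using \<theta> by (simp add: vec_eq_iff forall_2)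
    also have "\<dots> = h t" using R by (simp add: z_def)
    finally have "f (\<theta> / (2*pi)) = x" using proj t by (simp add: f_def)
    then show "x \<in> f ` {0..1}" using \<theta> by (intro image_eqI[of _ _ "\<theta> / (2*pi)"]) auto
  qed
  then show ?thesis unfolding perimeter_def
    using lip_f R by (intro length_measure_Lipschitz_image_le[of f]) auto
qed

section \<open>Homothets, discs and convex bodies\<close>

lemma ball_subset_homothet:
  fixes C :: "'a::real_normed_vector set"
  assumes "ball p r \<subseteq> C" "\<mu> > 0"
  shows "ball (\<mu> *\<^sub>R p + v) (\<mu> * r) \<subseteq> (\<lambda>x. \<mu> *\<^sub>R x + v) ` C"
proof
  fix y assume "y \<in> ball (\<mu> *\<^sub>R p + v) (\<mu> * r)"
  moreover define x where "x = (1/\<mu>) *\<^sub>R (y - v)"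
  then have y: "y = \<mu> *\<^sub>R x + v" using \<open>\<mu> > 0\<close> by simp
  ultimately have "norm (\<mu> *\<^sub>R (p - x)) < \<mu> * r" by (simp add: dist_norm algebra_simps)
  then have "x \<in> ball p r" using \<open>\<mu> > 0\<close> by (simp add: dist_norm)
  then show "y \<in> (\<lambda>x. \<mu> *\<^sub>R x + v) ` C" using assms(1) y by blast
qed

lemma homothet_subset_ball:
  fixes C :: "'a::real_normed_vector set"
  assumes "C \<subseteq> ball 0 R" "\<mu> > 0"
  shows "(\<lambda>x. \<mu> *\<^sub>R x + v) ` C \<subseteq> ball v (\<mu> * R)"
proof (rule image_subsetI)
  fix x assume "x \<in> C"
  then have "norm x < R" using assms(1) by auto
  then show "\<mu> *\<^sub>R x + v \<in> ball v (\<mu> * R)" using \<open>\<mu> > 0\<close> by (simp add: dist_norm)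
qed

lemma convex_body_inball:
  assumes "convex_body C"
  obtains p r where "r > 0" "ball p r \<subseteq> C"
  using assms unfolding convex_body_def by (metis equals0I mem_interior)

lemma convex_body_homothet:
  assumes C: "convex_body C" and "\<mu> > 0"
  shows "convex_body ((\<lambda>x. \<mu> *\<^sub>R x + v) ` C)"
proof -
  have eq: "(\<lambda>x. \<mu> *\<^sub>R x + v) ` C = (\<lambda>x. v + \<mu> *\<^sub>R x) ` C" by (simp add: add.commute)
  have "compact ((\<lambda>x. \<mu> *\<^sub>R x + v) ` C)"
    using C by (intro compact_continuous_image continuous_intros) (simp add: convex_body_def)
  moreover have "convex ((\<lambda>x. \<mu> *\<^sub>R x + v) ` C)"
    unfolding eq using C by (intro convex_affinity) (simp add: convex_body_def)
  moreover obtain p r where pr: "r > 0" "ball p r \<subseteq> C"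
    using convex_body_inball[OF C] .
  then have "\<mu> *\<^sub>R p + v \<in> interior ((\<lambda>x. \<mu> *\<^sub>R x + v) ` C)"
    using ball_subset_homothet[OF pr(2) \<open>\<mu> > 0\<close>, of v] \<open>\<mu> > 0\<close> by (metis mem_interior mult_pos_pos)
  ultimately show ?thesis unfolding convex_body_def by blast
qed

lemma convex_body_circumball:
  assumes "convex_body C"
  obtains R where "R > 0" "C \<subseteq> ball 0 R"
  using assms compact_imp_bounded bounded_subset_ballD unfolding convex_body_def by blast

section \<open>The upper bound by area comparison\<close>

text \<open>Each homothet contains a scaled copy of a disc in C. These discs are disjoint, so comparing
  areas bounds the sum of the squared ratios; Cauchy--Schwarz then bounds the sum of the ratios.\<close>

lemma total_perimeter_packing_le:
  assumes C: "convex_body C" and D: "convex_body D"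
  shows "\<exists>\<rho>>0. \<forall>S. packing S D \<and> (\<forall>K\<in>S. positive_homothet C K) \<longrightarrow>
    total_perimeter S \<le> ennreal (\<rho> * sqrt (real (card S)))"
proof -
  obtain p r where r: "r > 0" "ball p r \<subseteq> C" using convex_body_inball[OF C] .
  obtain R where R: "R > 0" "C \<subseteq> ball 0 R" using convex_body_circumball[OF C] .
  define a where "a = unit_ball_vol 2 * r\<^sup>2"
  have a: "a > 0" using r by (simp add: a_def)
  \<comment> \<open>The main term comes from the area bound and Cauchy-Schwarz; adding 1 makes
    positivity immediate.\<close>
  define \<rho> where "\<rho> = 4 * pi * R * sqrt (measure lborel D / a) + 1"
  show ?thesis
  proof (intro exI[of _ \<rho>] conjI allI impI; (elim conjE)?)
    show "\<rho> > 0" using R a unfolding \<rho>_def by (intro add_nonneg_pos mult_nonneg_nonneg) auto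
    fix S assume S: "packing S D" and hom: "\<forall>K\<in>S. positive_homothet C K"
    have fin: "finite S" and KD: "\<And>K. K \<in> S \<Longrightarrow> convex_body K \<and> K \<subseteq> D"
      and disj: "pairwise (\<lambda>K L. interior K \<inter> interior L = {}) S"
      using S unfolding packing_def by auto
    obtain \<mu> v where \<mu>: "\<And>K. K \<in> S \<Longrightarrow> \<mu> K > 0 \<and> K = (\<lambda>x. \<mu> K *\<^sub>R x + v K) ` C"
      using hom unfolding positive_homothet_def by metis
    define B where "B K = ball (\<mu> K *\<^sub>R p + v K) (\<mu> K * r)" for K
    have BK: "B K \<subseteq> interior K" if "K \<in> S" for K
      using ball_subset_homothet[OF r(2), of "\<mu> K" "v K"] \<mu>[OF that]
      unfolding B_def by (metis interior_maximal open_ball)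
    have "disjoint_family_on B S"
      unfolding disjoint_family_on_def using BK disj unfolding pairwise_def by blast
    then have "(\<Sum>K\<in>S. measure lborel (B K)) = measure lborel (\<Union>K\<in>S. B K)"
      using fin emeasure_lborel_ball_finite
      by (intro measure_finite_Union[symmetric]) (auto simp: B_def[abs_def] less_top)
    also have "\<dots> \<le> measure lborel D"
    proof (rule measure_mono_fmeasurable)
      show "(\<Union>K\<in>S. B K) \<subseteq> D" using BK KD interior_subset by blast
      show "(\<Union>K\<in>S. B K) \<in> sets lborel" by (auto simp: B_def intro!: borel_open)
      show "D \<in> fmeasurable lborel" using D by (simp add: convex_body_def fmeasurable_compact)
    qed
    also have "(\<Sum>K\<in>S. measure lborel (B K)) = (\<Sum>K\<in>S. a * (\<mu> K)\<^sup>2)"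
    proof (rule sum.cong[OF refl])
      fix K assume "K \<in> S"
      then have "\<mu> K * r \<ge> 0" using \<mu> r by (simp add: less_imp_le)
      then show "measure lborel (B K) = a * (\<mu> K)\<^sup>2"
        unfolding B_def a_def by (simp add: content_ball power_mult_distrib)
    qed
    finally have sq: "(\<Sum>K\<in>S. (\<mu> K)\<^sup>2) \<le> measure lborel D / a"
      using a by (simp add: sum_distrib_left[symmetric] field_simps)
    have "(\<Sum>K\<in>S. \<mu> K)\<^sup>2 \<le> (\<Sum>K\<in>S. (\<mu> K)\<^sup>2) * card S"
      by (rule sum_squared_le_sum_of_squares)
    also have "\<dots> \<le> measure lborel D / a * card S"
      using sq by (intro mult_right_mono) auto
    finally have sum_le: "(\<Sum>K\<in>S. \<mu> K) \<le> sqrt (measure lborel D / a) * sqrt (card S)"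
      by (simp add: real_le_rsqrt real_sqrt_mult[symmetric])
    have "total_perimeter S \<le> (\<Sum>K\<in>S. ennreal (4 * pi * (\<mu> K * R)))"
      unfolding total_perimeter_def
    proof (rule sum_mono)
      fix K assume "K \<in> S"
      then have "K \<subseteq> ball (v K) (\<mu> K * R)"
        using homothet_subset_ball[OF R(2), of "\<mu> K" "v K"] \<mu> by metis
      moreover have "closed K" "convex K" "interior K \<noteq> {}"
        using KD[OF \<open>K \<in> S\<close>] by (simp_all add: convex_body_def compact_imp_closed)
      ultimately show "perimeter K \<le> ennreal (4 * pi * (\<mu> K * R))"
        by (intro perimeter_le_circumradius)
    qed
    also have "\<dots> = ennreal (\<Sum>K\<in>S. 4 * pi * (\<mu> K * R))"
      using \<mu> R by (intro sum_ennreal) (simp add: less_imp_le)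
    also have "(\<Sum>K\<in>S. 4 * pi * (\<mu> K * R)) = 4 * pi * R * (\<Sum>K\<in>S. \<mu> K)"
      unfolding sum_distrib_left by (simp add: mult_ac)
    also have "ennreal \<dots> \<le> ennreal (\<rho> * sqrt (card S))"
    proof (rule ennreal_leI)
      have "4 * pi * R * (\<Sum>K\<in>S. \<mu> K) \<le> 4 * pi * R * (sqrt (measure lborel D / a) * sqrt (card S))"
        using sum_le R by (intro mult_left_mono) auto
      also have "\<dots> \<le> \<rho> * sqrt (card S)"
        unfolding \<rho>_def by (simp add: algebra_simps)
      finally show "4 * pi * R * (\<Sum>K\<in>S. \<mu> K) \<le> \<rho> * sqrt (card S)" .
    qed
    finally show "total_perimeter S \<le> ennreal (\<rho> * sqrt (real (card S)))" .
  qed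
qed

section \<open>The lower bound by a grid of equal copies\<close>

lemma exists_packing_total_perimeter_ge:
  assumes C: "convex_body C" and D: "convex_body D"
  shows "\<exists>\<sigma>>0. \<forall>n\<ge>1. \<exists>S. packing S D \<and> card S = n \<and> (\<forall>K\<in>S. positive_homothet C K) \<and>
    ennreal (\<sigma> * sqrt (real n)) \<le> total_perimeter S"
proof -
  obtain p r where r: "r > 0" "ball p r \<subseteq> C" using convex_body_inball[OF C] .
  obtain R where R: "R > 0" "C \<subseteq> ball 0 R" using convex_body_circumball[OF C] .
  obtain q s where s: "s > 0" "ball q s \<subseteq> D" using convex_body_inball[OF D] .
  \<comment> \<open>With k at most 2 sqrt n, each copy has \<mu> = s / (6 R k) and perimeter at
    least \<mu> r; n copies give at least this constant times sqrt n.\<close>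
  define \<sigma> where "\<sigma> = r * s / (12 * R)"
  show ?thesis
  proof (intro exI[of _ \<sigma>] conjI allI impI)
    show "\<sigma> > 0" using r R s by (simp add: \<sigma>_def)
    fix n :: nat assume n: "n \<ge> 1"
    define k where "k = nat \<lceil>sqrt n\<rceil>"
    have sqn: "sqrt n \<ge> 1" using n by simp
    \<comment> \<open>The bound k \<le> sqrt n + 1 \<le> 2 sqrt n is where n \<ge> 1 enters.\<close>
    then have k: "sqrt n \<le> k" "k \<le> 2 * sqrt n" "k > 0" unfolding k_def by linarith+
    have "real n \<le> real k ^ 2" using k(1) by (metis sqrt_le_D of_nat_0_le_iff)
    then have nk: "n \<le> k * k" by (metis of_nat_le_iff of_nat_power power2_eq_square)
    \<comment> \<open>Grid spacing. The grid has side less than k w, so its points are within 2 k w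
      of the corner q; the factor 3 leaves room in the disc of radius s for the copies
      themselves.\<close>
    define w where "w = s / (3 * k)"
    have w: "w > 0" using s k by (simp add: w_def)
    \<comment> \<open>Chosen so that each copy fits in a disc of radius w / 2 about its grid point;
      these open discs are disjoint.\<close>
    define \<mu> where "\<mu> = w / (2 * R)"
    have \<mu>: "\<mu> > 0" "\<mu> * R = w / 2" using w R by (simp_all add: \<mu>_def)
    \<comment> \<open>Quotient and remainder by k enumerate the k by k grid.\<close>
    define u :: "nat \<Rightarrow> real^2" where "u m = (\<chi> i. w * (if i = 1 then m div k else m mod k))" for m
    define K where "K m = (\<lambda>x. \<mu> *\<^sub>R x + (q + u m)) ` C" for m
    have cb: "convex_body (K m)" for m
      unfolding K_def using C \<mu>(1) by (rule convex_body_homothet)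
    have K_ball: "K m \<subseteq> ball (q + u m) (w / 2)" for m
      using homothet_subset_ball[OF R(2) \<mu>(1)] unfolding K_def \<mu>(2) .
    have u_dist: "w \<le> dist (u l) (u m)" if "l \<noteq> m" for l m
    proof -
      have gap: "w \<le> \<bar>w * real x - w * real y\<bar>" if "x \<noteq> y" for x y :: nat
      proof -
        have "1 \<le> \<bar>real x - real y\<bar>" using that by linarith
        then have "w * 1 \<le> w * \<bar>real x - real y\<bar>" using w by (intro mult_left_mono) auto
        then show ?thesis using w by (simp add: right_diff_distrib[symmetric] abs_mult)
      qed
      have "l div k \<noteq> m div k \<or> l mod k \<noteq> m mod k"
        using that by (metis div_mult_mod_eq)
      then have "\<exists>i. w \<le> dist (u l $ i) (u m $ i)"
      proof
        assume "l div k \<noteq> m div k"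
        from gap[OF this] show ?thesis
          by (intro exI[of _ 1]) (simp add: u_def dist_real_def)
      next
        assume "l mod k \<noteq> m mod k"
        from gap[OF this] show ?thesis
          by (intro exI[of _ 2]) (simp add: u_def dist_real_def)
      qed
      then show ?thesis using dist_vec_nth_le order_trans by blast
    qed
    have K_disj: "K l \<inter> K m = {}" if "l \<noteq> m" for l m
    proof -
      have "ball (q + u l) (w / 2) \<inter> ball (q + u m) (w / 2) = {}"
        using u_dist[OF that] by (intro disjoint_ballI) simp
      then show ?thesis using K_ball by blast
    qed
    have K_ne: "K m \<noteq> {}" for m
      using cb[of m] interior_subset unfolding convex_body_def by blast
    \<comment> \<open>A packing is a set, so the copies must be distinct both for its cardinality to
      be n and for the perimeters to be summed over m.\<close>
    have inj: "inj_on K {..<n}"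
      by (rule inj_onI) (metis K_disj K_ne inf.idem)
    have K_D: "K m \<subseteq> D" if "m < n" for m
    proof -
      have "m div k < k" using that nk by (simp add: less_mult_imp_div_less)
      moreover have "m mod k < k" using k by simp
      ultimately have "real (m div k) + real (m mod k) + 1 \<le> 2 * real k" by linarith
      then have "w * (real (m div k) + real (m mod k) + 1) \<le> w * (2 * real k)"
        using w by (intro mult_left_mono) auto
      moreover have "norm (u m) \<le> w * (real (m div k) + real (m mod k))"
        using norm_le_l1_cart[of "u m"] w by (simp add: sum_2 u_def abs_mult algebra_simps)
      ultimately have "norm (u m) + w \<le> 2 * (w * k)" by (simp add: algebra_simps)
      moreover have "3 * (w * k) = s" using k by (simp add: w_def)
      ultimately have "norm (u m) + w / 2 \<le> s" using w s by linarith
      then have "ball (q + u m) (w / 2) \<subseteq> ball q s"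
        by (simp add: ball_subset_ball_iff dist_norm)
      then show ?thesis using K_ball s(2) by blast
    qed
    let ?S = "K ` {..<n}"
    have "packing ?S D"
      unfolding packing_def
    proof (intro conjI)
      show "\<forall>L\<in>?S. convex_body L \<and> L \<subseteq> D" using cb K_D by auto
      show "pairwise (\<lambda>K L. interior K \<inter> interior L = {}) ?S"
      proof (rule pairwiseI)
        fix A B assume "A \<in> ?S" "B \<in> ?S" "A \<noteq> B"
        then have "A \<inter> B = {}" using K_disj by (metis imageE)
        then show "interior A \<inter> interior B = {}" by (simp flip: interior_Int)
      qed
    qed simp
    moreover have "card ?S = n" using card_image[OF inj] by simp
    moreover have "\<forall>L\<in>?S. positive_homothet C L"
      unfolding positive_homothet_def K_def using \<mu>(1) by blast
    moreover have "ennreal (\<sigma> * sqrt n) \<le> total_perimeter ?S"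
    proof -
      have "\<sigma> * sqrt n = r * s * sqrt n / (12 * R)" by (simp add: \<sigma>_def)
      also have "\<dots> \<le> real n * (\<mu> * r)"
      proof -
        have "sqrt n * k \<le> sqrt n * (2 * sqrt n)" using k by (intro mult_left_mono) auto
        also have "\<dots> = 2 * real n" by simp
        finally have "sqrt n * k \<le> 2 * real n" .
        then have "r * s / (12 * R * k) * (sqrt n * k) \<le> r * s / (12 * R * k) * (2 * real n)"
          using r s R by (intro mult_left_mono) auto
        moreover have "r * s * sqrt n / (12 * R) = r * s / (12 * R * k) * (sqrt n * k)"
          using k(3) by simp
        moreover have "real n * (\<mu> * r) = r * s / (12 * R * k) * (2 * real n)"
          by (simp add: \<mu>_def w_def mult.commute mult.left_commute)
        ultimately show ?thesis by (simp only:)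
      qed
      finally have "ennreal (\<sigma> * sqrt n) \<le> ennreal (real n * (\<mu> * r))" by (rule ennreal_leI)
      also have "\<dots> = (\<Sum>m<n. ennreal (\<mu> * r))"
        using \<mu>(1) r by (simp add: ennreal_mult' ennreal_of_nat_eq_real_of_nat)
      also have "\<dots> \<le> (\<Sum>m<n. perimeter (K m))"
      proof (rule sum_mono)
        fix m
        show "ennreal (\<mu> * r) \<le> perimeter (K m)"
        proof (rule perimeter_ge_inradius)
          show "bounded (K m)" using cb compact_imp_bounded unfolding convex_body_def by blast
          show "ball (\<mu> *\<^sub>R p + (q + u m)) (\<mu> * r) \<subseteq> K m"
            unfolding K_def using r(2) \<mu>(1) by (rule ball_subset_homothet)
        qed (use \<mu>(1) r(1) in simp)
      qed
      also have "\<dots> = total_perimeter ?S"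
        unfolding total_perimeter_def by (simp add: sum.reindex[OF inj])
      finally show ?thesis .
    qed
    ultimately show "\<exists>S. packing S D \<and> card S = n \<and> (\<forall>K\<in>S. positive_homothet C K) \<and>
       ennreal (\<sigma> * sqrt (real n)) \<le> total_perimeter S"
      by (intro exI[of _ ?S] conjI)
  qed
qed

theorem proposition1:
  fixes C D :: "(real^2) set"
  assumes "convex_body C" and "convex_body D"
  shows "(\<exists>\<rho>::real. \<rho> > 0 \<and>
            (\<forall>n::nat. n \<ge> 1 \<longrightarrow>
               (\<forall>S. packing S D \<and> card S = n \<and> (\<forall>K\<in>S. positive_homothet C K) \<longrightarrow>
                  total_perimeter S \<le> ennreal (\<rho> * sqrt (real n))))) \<and>
         (\<exists>\<sigma>::real. \<sigma> > 0 \<and>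
            (\<forall>n::nat. n \<ge> 1 \<longrightarrow>
               (\<exists>S. packing S D \<and> card S = n \<and> (\<forall>K\<in>S. positive_homothet C K) \<and>
                  total_perimeter S \<ge> ennreal (\<sigma> * sqrt (real n)))))"
proof (rule conjI)
  obtain \<rho> where \<rho>: "\<rho> > 0" "\<forall>S. packing S D \<and> (\<forall>K\<in>S. positive_homothet C K) \<longrightarrow>
    total_perimeter S \<le> ennreal (\<rho> * sqrt (real (card S)))"
    using total_perimeter_packing_le[OF assms] by (elim exE conjE)
  show "\<exists>\<rho>::real. \<rho> > 0 \<and>
            (\<forall>n::nat. n \<ge> 1 \<longrightarrow>
               (\<forall>S. packing S D \<and> card S = n \<and> (\<forall>K\<in>S. positive_homothet C K) \<longrightarrow>
                  total_perimeter S \<le> ennreal (\<rho> * sqrt (real n))))"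
  proof (intro exI[of _ \<rho>] conjI allI impI; (elim conjE)?)
    fix n S assume "packing S D" "card S = n" "\<forall>K\<in>S. positive_homothet C K"
    then show "total_perimeter S \<le> ennreal (\<rho> * sqrt (real n))" using \<rho>(2) by blast
  qed (rule \<rho>(1))
qed (rule exists_packing_total_perimeter_ge[OF assms])

end
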